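(* Let $X$ be a topological space and let $\mathfrak{B}$ be a collection of open subsets of $X$ satisfying the properties $(B_I)$ and $(B_{II})$. Then the collection $$\mathfrak{U}=\{V\subset X\times X : \text{there exists } C\in\mathfrak{C}\text{ such that } V(C)\subset V\}$$ defines a uniform structure on $X$.
   Context: $\mathfrak{C}$ denotes the collection of all finite covers of $X$ by elements of $\mathfrak{B}$. The properties are: $(B_I)$ Every non-empty finite intersection of elements of $\mathfrak{B}$ belongs to $\mathfrak{B}$ (here "finite intersection" includes the intersection of the empty family, which is $X$). $(B_{II})$ For every cover $C\in\mathfrak{C}$ there is a cover $C'\in\mathfrak{C}$ such that for every point $x\in X$ the union of all the elements of $C'$ containing $x$ is contained in one of the elements of $C$. For $C\in\mathfrak{C}$, $V(C)=\bigcup_{Y\in C}Y\times Y\subset X\times X$. A uniform structure on $X$ is a collection $\mathfrak{U}$ of subsets of $X\times X$ that is closed under supersets (in $X\times X$) and finite intersections (including the empty one), all of whose elements contain the diagonal, such that $V\in\mathfrak{U}$ implies $V^{-1}\in\mathfrak{U}$, and such that for every $V\in\mathfrak{U}$ there is $W\in\mathfrak{U}$ with $W\circ W\subset V$. *)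

theory Defs
  imports "HOL-Analysis.Abstract_Topology"
begin

text \<open>The library class for uniform spaces ties the uniformity to the topology of a type, whereas
  here a uniform structure on a carrier set is wanted, with no relation to a given topology.
  Intersecting with \<open>S \<times> S\<close> gives the intersection of the empty family its intended value.\<close>

definition uniform_structure_on :: "'a set \<Rightarrow> ('a \<times> 'a) set set \<Rightarrow> bool" where
  "uniform_structure_on S \<U> \<longleftrightarrow>
     \<U> \<subseteq> Pow (S \<times> S) \<and>
     (\<forall>V\<in>\<U>. \<forall>W. V \<subseteq> W \<and> W \<subseteq> S \<times> S \<longrightarrow> W \<in> \<U>) \<and>
     (\<forall>\<F>. finite \<F> \<and> \<F> \<subseteq> \<U> \<longrightarrow> (S \<times> S) \<inter> \<Inter>\<F> \<in> \<U>) \<and>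
     (\<forall>V\<in>\<U>. Id_on S \<subseteq> V) \<and>
     (\<forall>V\<in>\<U>. V\<inverse> \<in> \<U>) \<and>
     (\<forall>V\<in>\<U>. \<exists>W\<in>\<U>. W O W \<subseteq> V)"

definition finite_covers :: "'a set \<Rightarrow> 'a set set \<Rightarrow> 'a set set set" where
  "finite_covers S \<B> = {C. finite C \<and> C \<subseteq> \<B> \<and> \<Union>C = S}"

text \<open>``Non-empty'' refers to the intersection as a set; the family \<open>\<F>\<close> may be empty, in which
  case its intersection is \<open>S\<close>.\<close>

definition property_BI :: "'a set \<Rightarrow> 'a set set \<Rightarrow> bool" where
  "property_BI S \<B> \<longleftrightarrow>
     (\<forall>\<F>. finite \<F> \<and> \<F> \<subseteq> \<B> \<and> S \<inter> \<Inter>\<F> \<noteq> {} \<longrightarrow> S \<inter> \<Inter>\<F> \<in> \<B>)"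

definition property_BII :: "'a set \<Rightarrow> 'a set set \<Rightarrow> bool" where
  "property_BII S \<B> \<longleftrightarrow>
     (\<forall>C\<in>finite_covers S \<B>. \<exists>C'\<in>finite_covers S \<B>.
        \<forall>x\<in>S. \<exists>Y\<in>C. \<Union>{Z\<in>C'. x \<in> Z} \<subseteq> Y)"

definition cover_entourage :: "'a set set \<Rightarrow> ('a \<times> 'a) set" where
  "cover_entourage C = (\<Union>Y\<in>C. Y \<times> Y)"

end

theory Submission
  imports Defs
begin

text \<open>Two operations on finite covers carry the proof. Passing to the common refinement, whose
  members are the non-empty \<open>Y \<inter> Z\<close> and hence lie in \<open>\<B>\<close> by \<open>(B\<^sub>I)\<close>, gives
  closure under intersections; passing to the star refinement of \<open>(B\<^sub>I\<^sub>I)\<close> gives the square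
  root of an entourage: two overlapping members of the refinement both contain a common point
  \<open>y\<close>, so both lie in the star of \<open>y\<close>, and hence in a single member of the original cover. The
  diagonal and inverse axioms hold because \<open>cover_entourage C\<close> contains the diagonal and is
  symmetric.\<close>

lemma Id_on_subset_cover_entourage:
  assumes "\<Union>C = S"
  shows "Id_on S \<subseteq> cover_entourage C"
  using assms by (auto simp: cover_entourage_def)

lemma converse_cover_entourage: "(cover_entourage C)\<inverse> = cover_entourage C"
  by (auto simp: cover_entourage_def)

text \<open>The cover \<open>{S}\<close> serves when \<open>S\<close> is non-empty. Otherwise \<open>(B\<^sub>I)\<close> does not put \<open>S\<close>
  into \<open>\<B>\<close>, and the empty family of sets is the cover.\<close>

lemma finite_covers_nonempty:
  assumes "property_BI S \<B>"
  shows "finite_covers S \<B> \<noteq> {}"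
proof (cases "S = {}")
  case True
  then have "{} \<in> finite_covers S \<B>"
    by (simp add: finite_covers_def)
  then show ?thesis by blast
next
  case False
  then have "S \<in> \<B>"
    using assms[unfolded property_BI_def, rule_format, of "{}"] by simp
  then have "{S} \<in> finite_covers S \<B>"
    by (simp add: finite_covers_def)
  then show ?thesis by blast
qed

lemma property_BI_Int:
  assumes "property_BI S \<B>" "Y \<in> \<B>" "Z \<in> \<B>" "Y \<subseteq> S" "Y \<inter> Z \<noteq> {}"
  shows "Y \<inter> Z \<in> \<B>"
proof -
  have "S \<inter> \<Inter>{Y, Z} = Y \<inter> Z"
    using assms(4) by auto
  then show ?thesis
    using assms(1)[unfolded property_BI_def, rule_format, of "{Y, Z}"] assms(2,3,5) by simp
qed

text \<open>The witness is the common refinement. Empty intersections are left out because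
  \<open>(B\<^sub>I)\<close> does not put the empty set into \<open>\<B>\<close>; the union is not affected.\<close>

lemma finite_covers_common_refinement:
  assumes BI: "property_BI S \<B>"
    and C: "C \<in> finite_covers S \<B>" and D: "D \<in> finite_covers S \<B>"
  obtains E where "E \<in> finite_covers S \<B>"
    and "cover_entourage E \<subseteq> cover_entourage C \<inter> cover_entourage D"
proof
  let ?E = "(\<lambda>(Y, Z). Y \<inter> Z) ` (C \<times> D) - {{}}"
  have "finite ?E"
    using C D by (simp add: finite_covers_def)
  moreover have "?E \<subseteq> \<B>"
  proof
    fix W assume "W \<in> ?E"
    then obtain Y Z where "Y \<in> C" "Z \<in> D" "W = Y \<inter> Z" "Y \<inter> Z \<noteq> {}"
      by auto
    moreover from this have "Y \<in> \<B>" "Z \<in> \<B>" "Y \<subseteq> S"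
      using C D by (auto simp: finite_covers_def)
    ultimately show "W \<in> \<B>"
      using property_BI_Int[OF BI] by simp
  qed
  moreover have "\<Union>?E = \<Union>C \<inter> \<Union>D"
  proof
    show "\<Union>?E \<subseteq> \<Union>C \<inter> \<Union>D"
      by auto
    show "\<Union>C \<inter> \<Union>D \<subseteq> \<Union>?E"
    proof
      fix x assume "x \<in> \<Union>C \<inter> \<Union>D"
      then obtain Y Z where "Y \<in> C" "Z \<in> D" and x: "x \<in> Y \<inter> Z"
        by blast
      then have "Y \<inter> Z \<in> ?E"
        by (auto intro: image_eqI[of _ _ "(Y, Z)"])
      with x show "x \<in> \<Union>?E"
        by (rule UnionI[rotated])
    qed
  qed
  ultimately show "?E \<in> finite_covers S \<B>"
    using C D by (simp add: finite_covers_def)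
  show "cover_entourage ?E \<subseteq> cover_entourage C \<inter> cover_entourage D"
    by (auto simp: cover_entourage_def)
qed

lemma finite_covers_square_root:
  assumes BII: "property_BII S \<B>" and C: "C \<in> finite_covers S \<B>"
  obtains D where "D \<in> finite_covers S \<B>"
    and "cover_entourage D O cover_entourage D \<subseteq> cover_entourage C"
proof -
  from BII[unfolded property_BII_def, rule_format, OF C] obtain D where D: "D \<in> finite_covers S \<B>"
    and star: "\<forall>y\<in>S. \<exists>Y\<in>C. \<Union>{Z\<in>D. y \<in> Z} \<subseteq> Y"
    ..
  have "cover_entourage D O cover_entourage D \<subseteq> cover_entourage C"
  proof (rule subsetI, elim relcompE)
    fix p x y z
    assume p: "p = (x, z)" and "(x, y) \<in> cover_entourage D" "(y, z) \<in> cover_entourage D"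
    then obtain Z\<^sub>1 Z\<^sub>2 where Z: "Z\<^sub>1 \<in> D" "x \<in> Z\<^sub>1" "y \<in> Z\<^sub>1" "Z\<^sub>2 \<in> D" "y \<in> Z\<^sub>2" "z \<in> Z\<^sub>2"
      by (auto simp: cover_entourage_def)
    with D have "y \<in> S"
      by (auto simp: finite_covers_def)
    with star obtain Y where "Y \<in> C" "\<Union>{Z\<in>D. y \<in> Z} \<subseteq> Y"
      by (auto dest: bspec)
    with Z have "Y \<in> C" "x \<in> Y" "z \<in> Y"
      by blast+
    with p show "p \<in> cover_entourage C"
      by (auto simp: cover_entourage_def)
  qed
  with D show thesis
    by (rule that)
qed

lemma cover_entourage_subset:
  assumes "C \<in> finite_covers S \<B>"
  shows "cover_entourage C \<subseteq> S \<times> S"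
  using assms by (auto simp: finite_covers_def cover_entourage_def)

lemma finite_covers_refine_Inter:
  assumes BI: "property_BI S \<B>" and "finite \<F>"
    and "\<And>V. V \<in> \<F> \<Longrightarrow> \<exists>C\<in>finite_covers S \<B>. cover_entourage C \<subseteq> V"
  shows "\<exists>C\<in>finite_covers S \<B>. cover_entourage C \<subseteq> \<Inter>\<F>"
  using assms(2,3)
proof (induction \<F> rule: finite_induct)
  case empty
  show ?case
    using finite_covers_nonempty[OF BI] by auto
next
  case (insert V \<F>)
  obtain C where C: "C \<in> finite_covers S \<B>" "cover_entourage C \<subseteq> \<Inter>\<F>"
    using insert by blast
  obtain D where D: "D \<in> finite_covers S \<B>" "cover_entourage D \<subseteq> V"
    using insert.prems by blast
  obtain E where "E \<in> finite_covers S \<B>"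
    "cover_entourage E \<subseteq> cover_entourage C \<inter> cover_entourage D"
    using finite_covers_common_refinement[OF BI C(1) D(1)] .
  with C(2) D(2) show ?case
    by (intro bexI[of _ E]) auto
qed

lemma uniform_structure_on_finite_covers:
  assumes BI: "property_BI S \<B>" and BII: "property_BII S \<B>"
  shows "uniform_structure_on S
           {V. V \<subseteq> S \<times> S \<and> (\<exists>C\<in>finite_covers S \<B>. cover_entourage C \<subseteq> V)}"
    (is "uniform_structure_on S ?\<U>")
  unfolding uniform_structure_on_def
proof (intro conjI ballI allI impI)
  show "?\<U> \<subseteq> Pow (S \<times> S)"
    by blast
next
  fix V W assume "V \<in> ?\<U>" "V \<subseteq> W \<and> W \<subseteq> S \<times> S"
  then show "W \<in> ?\<U>"
    by blast
next
  fix \<F> assume \<F>: "finite \<F> \<and> \<F> \<subseteq> ?\<U>"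
  then obtain C where "C \<in> finite_covers S \<B>" "cover_entourage C \<subseteq> \<Inter>\<F>"
    using finite_covers_refine_Inter[OF BI, of \<F>] by blast
  then show "(S \<times> S) \<inter> \<Inter>\<F> \<in> ?\<U>"
    using cover_entourage_subset by blast
next
  fix V assume "V \<in> ?\<U>"
  then obtain C where C: "V \<subseteq> S \<times> S" "C \<in> finite_covers S \<B>" "cover_entourage C \<subseteq> V"
    by blast
  then have "\<Union>C = S"
    by (simp add: finite_covers_def)
  then show "Id_on S \<subseteq> V"
    using Id_on_subset_cover_entourage C(3) by (metis subset_trans)
  have "cover_entourage C \<subseteq> V\<inverse>"
    using C(3) by (subst converse_cover_entourage[symmetric]) (rule converse_mono[THEN iffD2])
  with C(1,2) show "V\<inverse> \<in> ?\<U>"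
    by blast
  obtain D where D: "D \<in> finite_covers S \<B>"
    "cover_entourage D O cover_entourage D \<subseteq> cover_entourage C"
    using finite_covers_square_root[OF BII C(2)] .
  have "cover_entourage D \<in> ?\<U>"
    using D(1) cover_entourage_subset[OF D(1)] by blast
  moreover have "cover_entourage D O cover_entourage D \<subseteq> V"
    using D(2) C(3) by (rule subset_trans)
  ultimately show "\<exists>W\<in>?\<U>. W O W \<subseteq> V" ..
qed

theorem proposition3p2:
  fixes X :: "'a topology" and \<B> :: "'a set set"
  assumes "\<And>B. B \<in> \<B> \<Longrightarrow> openin X B"
    and "property_BI (topspace X) \<B>"
    and "property_BII (topspace X) \<B>"
  shows "uniform_structure_on (topspace X)
           {V. V \<subseteq> topspace X \<times> topspace X \<and>
               (\<exists>C\<in>finite_covers (topspace X) \<B>. cover_entourage C \<subseteq> V)}"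
  using assms(2,3) by (rule uniform_structure_on_finite_covers)

end
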